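(* Let $(\xi_i\,\varphi_i)_{i\ge 1}$ be any rearrangement (that is, any enumeration by $i=1,2,3,\dots$, each term appearing exactly once) of the terms of the Haar-based series representation $$R^{3/2}(t)= \xi_{-1}\, \frac{t^{3/2}}{\Gamma(5/2)}+\sum_{j=0}^\infty \sum_{k=0}^{2^j-1} \xi_{j,k}\,(R_{3/2} h_{j,k})(t),\qquad t\in[0,1],$$ of the Riemann--Liouville process $R^{3/2}$. Here $\varphi_i$ runs over the deterministic functions $t\mapsto t^{3/2}/\Gamma(5/2)$ and $R_{3/2}h_{j,k}$, and $\xi_i$ is the corresponding standard normal coefficient. Then $$\mathbb{E}\left\|\sum_{i=n}^{\infty} \xi_i\, \varphi_i\right\|_\infty \succeq n^{-1}\ln n \qquad \text{as } n\to\infty,$$ i.e. $$\liminf_{n\to\infty}\ \frac{\mathbb{E}\left\|\sum_{i=n}^{\infty} \xi_i\, \varphi_i\right\|_\infty}{n^{-1}\ln n}>0.$$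
   Context: $\|\cdot\|_\infty$ is the uniform norm on $C[0,1]$. The Haar functions are, for $j\ge 0$ and $0\le k\le 2^j-1$, $$h_{j,k}(t)= 2^{j/2} \left\{ \mathbf{1}_{\left[\frac{2k}{2^{j+1}}, \frac{2k+1}{2^{j+1}}\right)} (t) - \mathbf{1}_{\left[\frac{2k+1}{2^{j+1}}, \frac{2k+2}{2^{j+1}}\right)} (t) \right\},\qquad t\in[0,1].$$ For $\alpha>1/2$, the Riemann--Liouville integration operator is $$R_\alpha h(t)=\frac{1}{\Gamma(\alpha)} \int_0^t (t-u)^{\alpha-1} h(u)\, du,$$ and the Riemann--Liouville process is $R^\alpha(t)=\frac{1}{\Gamma(\alpha)} \int_0^t (t-u)^{\alpha-1}\, dW(u)$, $0\le t\le 1$, where $W$ is a Wiener process. It has continuous sample paths. The family $\{\xi_{-1}, (\xi_{j,k})_{j\ge 0,\,0\le k\le 2^j-1}\}$ consists of i.i.d. standard normal random variables. The Haar-based series converges almost surely uniformly on $[0,1]$ to the process. *)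

theory Defs
  imports "HOL-Probability.Probability"
begin

definition haar :: "nat \<Rightarrow> nat \<Rightarrow> real \<Rightarrow> real" where
  "haar j k t = 2 powr (real j / 2) *
     (indicator {real (2 * k) / 2 ^ (j + 1) ..< real (2 * k + 1) / 2 ^ (j + 1)} t
      - indicator {real (2 * k + 1) / 2 ^ (j + 1) ..< real (2 * k + 2) / 2 ^ (j + 1)} t)"

text \<open>
  Riemann--Liouville fractional integration of order a > 1/2. For a < 1 the kernel is singular
  only at the endpoint u = t, a null set on which powr takes the value 0.
\<close>

definition RL_integral :: "real \<Rightarrow> (real \<Rightarrow> real) \<Rightarrow> real \<Rightarrow> real" where
  "RL_integral a h t =
     1 / Gamma a * (LINT u:{0..t}|lborel. (t - u) powr (a - 1) * h u)"

text \<open>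
  Indices of the series: Initial stands for the index -1, and Haar j k for the pair (j, k).
  Only the pairs with k < 2 ^ j occur in the series, so a family indexed by this type
  is meaningful on the set haar_indices only.
\<close>

datatype haar_index = Initial | Haar nat nat

definition haar_indices :: "haar_index set" where
  "haar_indices = insert Initial {Haar j k | j k. k < 2 ^ j}"

fun series_fun :: "haar_index \<Rightarrow> real \<Rightarrow> real" where
  "series_fun Initial t = t powr (3 / 2) / Gamma (5 / 2)"
| "series_fun (Haar j k) t = RL_integral (3 / 2) (haar j k) t"

text \<open>
  The norm is extended-valued so that the supremum and the expectation below are meaningful
  without a boundedness or integrability side condition.
\<close>

definition unif_norm :: "(real \<Rightarrow> real) \<Rightarrow> ennreal" where
  "unif_norm f = (SUP t\<in>{0..1}. ennreal \<bar>f t\<bar>)"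

text \<open>
  The tail of the series enumerated by s, for one realisation x of the coefficients.
  It is written as a pointwise sum in t; whenever the series converges in C[0,1], this is its
  limit there. For independent standard normal coefficients that happens almost surely and
  for every enumeration s at once: the sum over k of the absolute values of
  series_fun (Haar j k) t is bounded by a constant times 2 powr (- j / 2), uniformly in t,
  while the coefficients of level j are almost surely of order at most sqrt j, so the series
  converges absolutely and uniformly on [0,1].
\<close>

definition series_tail ::
    "(haar_index \<Rightarrow> real) \<Rightarrow> (nat \<Rightarrow> haar_index) \<Rightarrow> nat \<Rightarrow> real \<Rightarrow> real" where
  "series_tail x s n t = (\<Sum>i. x (s (n + i)) * series_fun (s (n + i)) t)"

end

theory Submission imports Defs begin

text \<open>
  Write \<open>N = 2 ^ j\<close>. The fractional integral \<open>R\<^bsub>3/2\<^esub> h\<^bsub>j,k\<^esub>\<close> vanishes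
  to the left of \<open>k / N\<close>, but to the right of the support of \<open>h\<^bsub>j,k\<^esub>\<close> it decays only like the inverse
  square root of the distance: at \<open>m / N\<close> with \<open>m > k\<close> it is at least \<open>c / (N * sqrt (m - k))\<close>.
  At a grid point the terms of level \<open>j\<close> therefore have total variance of order
  \<open>N powr -2\<close> times a harmonic sum, that is \<open>j / N\<^sup>2\<close>. The maximum over polynomially (in \<open>N\<close>) many
  nearly independent grid points gains another factor \<open>sqrt j\<close>, so the norm of the tail is of order
  \<open>j / N\<close>. With \<open>N\<close> comparable to \<open>n\<close> this is \<open>ln n / n\<close>.

  An arbitrary enumeration may have spent its first terms on level \<open>j\<close>. If \<open>8 * n \<le> N\<close>, at most an
  eighth of that level is missing from the tail. Cut the level into blocks of about \<open>2 * sqrt N\<close>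
  consecutive indices. At least half of them are light, in that they have lost few terms, and
  averaging over the right half of a light block gives a point \<open>m\<close> to the left of which, inside the same
  block, half of the harmonic sum survives (\<open>card_light_blocks_ge\<close>, \<open>exists_large_harmonic_window\<close>).

  The maximum is controlled by independence and symmetry. At the point chosen in a block, the tail is
  \<open>A + B\<close>, where \<open>A\<close> collects the terms of level \<open>j\<close> from this block, and \<open>B\<close> is independent of \<open>A\<close>.
  Since terms with support further right vanish there, the values at the points of the earlier
  blocks are also functions of coefficients independent of \<open>A\<close>. As \<open>A\<close> is symmetric, a shift by \<open>B\<close> does
  not help to make \<open>\<bar>A + B\<bar>\<close> small, so the probability that all values are small
  is at most the product of \<open>1 - P(A \<ge> \<theta>)\<close> over the light blocks (\<open>prob_all_small_le\<close>). A lower bound for the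
  Gaussian tail makes this product at most one half when \<open>\<theta>\<close> is a small multiple of \<open>j / N\<close>
  (\<open>expected_norm_series_tail_ge\<close>).

  Splitting the pointwise sum into \<open>A\<close> and \<open>B\<close> requires its convergence. At a fixed point the functions
  are absolutely summable over all indices (\<open>summable_on_abs_series_fun\<close>), so the series converges
  absolutely with probability one in every order.
\<close>

section \<open>Integrated Haar functions\<close>

text \<open>
  The power \<open>x powr (3 / 2)\<close> of the positive part, which absorbs the upper limit \<open>t\<close> of the fractional
  integral.
\<close>

definition pos_pow32 :: "real \<Rightarrow> real" where
  "pos_pow32 x = max 0 x * sqrt (max 0 x)"

lemma has_real_derivative_pos_pow32:
  "(pos_pow32 has_real_derivative 3 / 2 * sqrt (max 0 x)) (at x)"
proof -
  consider "x < 0" | "x = 0" | "x > 0" by linarith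
  then show ?thesis
  proof cases
    case 1
    have "((\<lambda>x::real. 0::real) has_real_derivative 3 / 2 * sqrt (max 0 x)) (at x)"
      using 1 by (simp add: max_def)
    moreover have "eventually (\<lambda>y. pos_pow32 y = 0) (nhds x)"
      using eventually_nhds_in_open[of "{..<0}" x] 1
      by (auto elim!: eventually_mono simp: pos_pow32_def max_def)
    ultimately show ?thesis
      using DERIV_cong_ev[OF refl _ refl, of pos_pow32 "\<lambda>_. 0" x] by auto
  next
    case 2
    have "((\<lambda>h. sqrt (max 0 h)) \<longlongrightarrow> sqrt (max 0 0)) (at (0::real))"
      by (intro tendsto_intros)
    then have *: "((\<lambda>h::real. sqrt (max 0 h)) \<longlongrightarrow> 0) (at 0)" by simp
    have "((\<lambda>h. pos_pow32 h / h) \<longlongrightarrow> 0) (at 0)"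
      by (rule tendsto_0_le[OF *, of _ 1]) (auto simp: pos_pow32_def max_def eventually_at_filter)
    then show ?thesis using 2 by (simp add: DERIV_def pos_pow32_def)
  next
    case 3
    have "((\<lambda>x. x * sqrt x) has_real_derivative 3 / 2 * sqrt (max 0 x)) (at x)"
      using 3 by (auto intro!: derivative_eq_intros simp: field_simps max_def)
    moreover have "eventually (\<lambda>y. pos_pow32 y = y * sqrt y) (nhds x)"
      using eventually_nhds_in_open[of "{0<..}" x] 3
      by (auto elim!: eventually_mono simp: pos_pow32_def max_def)
    ultimately show ?thesis
      using DERIV_cong_ev[OF refl _ refl, of pos_pow32 "\<lambda>x. x * sqrt x" x] by auto
  qed
qed

lemma pos_pow32_diff_mvt:
  assumes "d > 0"
  obtains z where "x - d < z" "z < x" "pos_pow32 x - pos_pow32 (x - d) = 3 / 2 * d * sqrt (max 0 z)"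
proof -
  from MVT2[of "x - d" x pos_pow32 "\<lambda>x. 3 / 2 * sqrt (max 0 x)"] assms has_real_derivative_pos_pow32
  obtain z where "z > x - d" "z < x" "pos_pow32 x - pos_pow32 (x - d) = (x - (x - d)) * (3 / 2 * sqrt (max 0 z))"
    by auto
  then show ?thesis by (intro that[of z]) (auto simp: algebra_simps)
qed

definition second_diff :: "real \<Rightarrow> real \<Rightarrow> real" where
  "second_diff d x = pos_pow32 x - 2 * pos_pow32 (x - d) + pos_pow32 (x - 2 * d)"

text \<open>
  The mean value theorem is applied to a first difference only: the second derivative of
  \<open>pos_pow32\<close> blows up at the origin.
\<close>

lemma second_diff_mvt:
  assumes "d > 0"
  obtains z where "x - d < z" "z < x"
    "second_diff d x = 3 / 2 * d * (sqrt (max 0 z) - sqrt (max 0 (z - d)))"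
proof -
  have der: "((\<lambda>x. pos_pow32 x - pos_pow32 (x - d)) has_real_derivative
     (3 / 2 * sqrt (max 0 z) - 3 / 2 * sqrt (max 0 (z - d)))) (at z)" for z
    by (rule derivative_eq_intros has_real_derivative_pos_pow32
        DERIV_chain2[OF has_real_derivative_pos_pow32] refl | simp)+
  from MVT2[of "x - d" x "\<lambda>x. pos_pow32 x - pos_pow32 (x - d)"
     "\<lambda>z. (3 / 2 * sqrt (max 0 z) - 3 / 2 * sqrt (max 0 (z - d)))"] assms der
  obtain z where "z > x - d" "z < x" "pos_pow32 x - pos_pow32 (x - d) - (pos_pow32 (x - d) - pos_pow32 (x - d - d)) =
     (x - (x - d)) * (3 / 2 * sqrt (max 0 z) - 3 / 2 * sqrt (max 0 (z - d)))"
    by auto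
  then show ?thesis
    by (intro that[of z]) (auto simp: second_diff_def algebra_simps)
qed

lemma second_diff_nonneg:
  assumes "d > 0" shows "second_diff d x \<ge> 0"
proof -
  obtain z where "second_diff d x = 3 / 2 * d * (sqrt (max 0 z) - sqrt (max 0 (z - d)))"
    using second_diff_mvt[OF assms] by blast
  moreover have "0 \<le> 3 / 2 * d * (sqrt (max 0 z) - sqrt (max 0 (z - d)))"
    using assms by (intro mult_nonneg_nonneg) auto
  ultimately show ?thesis by linarith
qed

lemma second_diff_eq_0: "d \<ge> 0 \<Longrightarrow> x \<le> 0 \<Longrightarrow> second_diff d x = 0"
  by (simp add: second_diff_def pos_pow32_def max_def)

text \<open>
  The slow decay \<open>x powr (-1/2)\<close> of the second derivative of \<open>x powr (3/2)\<close>, which is the source of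
  the extra logarithm.
\<close>

lemma second_diff_ge:
  assumes "d > 0" "2 * d \<le> x"
  shows "second_diff d x \<ge> 3 / 4 * d\<^sup>2 / sqrt x"
proof -
  obtain z where z: "x - d < z" "z < x"
    and eq: "second_diff d x = 3 / 2 * d * (sqrt (max 0 z) - sqrt (max 0 (z - d)))"
    using second_diff_mvt[OF assms(1)] by blast
  have pos: "z - d > 0" "z > 0" "x > 0" using z assms by linarith+
  have "sqrt z - sqrt (z - d) = d / (sqrt z + sqrt (z - d))"
    using pos by (simp add: eq_divide_eq square_diff_square_factored[symmetric] algebra_simps
        add_pos_pos[THEN less_imp_neq, symmetric])
  also have "\<dots> \<ge> d / (sqrt x + sqrt x)"
    using pos z assms by (intro divide_left_mono add_mono mult_pos_pos add_pos_pos) auto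
  finally have "sqrt z - sqrt (z - d) \<ge> d / (2 * sqrt x)" by simp
  then have "3 / 2 * d * (d / (2 * sqrt x)) \<le> second_diff d x"
    unfolding eq using pos assms by (intro mult_left_mono) (auto simp: max_def)
  then show ?thesis by (simp add: power2_eq_square)
qed

text \<open>
  A second difference is a difference of two first differences at distance \<open>d\<close>. These are monotone,
  so extending each to distance \<open>2 * d\<close> only enlarges it and makes the sum telescope.
\<close>

lemma sum_second_diff_le:
  assumes "d > 0" "x \<le> 1"
  shows "(\<Sum>k<n. second_diff d (x - 2 * real k * d)) \<le> 3 / 2 * d"
proof -
  define G where "G y = pos_pow32 y - pos_pow32 (y - d)" for y
  have G: "0 \<le> G y" "y \<le> 1 \<Longrightarrow> G y \<le> 3 / 2 * d" for y
  proof -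
    obtain z where z: "y - d < z" "z < y" "G y = 3 / 2 * d * sqrt (max 0 z)"
      unfolding G_def using pos_pow32_diff_mvt[OF assms(1)] by blast
    show "0 \<le> G y" unfolding z(3) using assms by (intro mult_nonneg_nonneg) auto
    assume "y \<le> 1"
    then have "sqrt (max 0 z) \<le> 1" using z by simp
    then show "G y \<le> 3 / 2 * d" using z assms by simp
  qed
  have "second_diff d (x - 2 * real k * d) \<le> G (x - 2 * real k * d) - G (x - 2 * real (Suc k) * d)" for k
    using second_diff_nonneg[OF assms(1), of "x - 2 * real k * d - d"]
    by (simp add: G_def second_diff_def algebra_simps)
  then have "(\<Sum>k<n. second_diff d (x - 2 * real k * d)) \<le>
      (\<Sum>k<n. G (x - 2 * real k * d) - G (x - 2 * real (Suc k) * d))"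
    by (intro sum_mono)
  also have "\<dots> = G x - G (x - 2 * real n * d)"
    by (subst sum_lessThan_telescope') simp
  also have "\<dots> \<le> 3 / 2 * d" using G(1)[of "x - 2 * real n * d"] G(2)[of x] assms by simp
  finally show ?thesis .
qed

text \<open>
  Replacing the kernel by \<open>sqrt (max 0 (t - u))\<close> removes the cut-off at \<open>t\<close>, so that one antiderivative
  serves all positions of \<open>t\<close> relative to \<open>a\<close> and \<open>b\<close>.
\<close>

lemma has_bochner_integral_sqrt_kernel_Ico:
  assumes "0 \<le> a" "a \<le> b"
  shows "has_bochner_integral lborel
     (\<lambda>u. indicator {0..t} u *\<^sub>R ((t - u) powr (1 / 2) * indicator {a..<b} u))
     (2 / 3 * (pos_pow32 (t - a) - pos_pow32 (t - b)))"
proof -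
  have "has_bochner_integral lborel (\<lambda>u. sqrt (max 0 (t - u)) * indicator {a..b} u)
     ((- (2 / 3) * pos_pow32 (t - b)) - (- (2 / 3) * pos_pow32 (t - a)))"
  proof (rule has_bochner_integral_FTC_Icc_nonneg)
    show "((\<lambda>u. - (2 / 3) * pos_pow32 (t - u)) has_real_derivative sqrt (max 0 (t - x))) (at x)" for x
      by (rule derivative_eq_intros DERIV_chain2[OF has_real_derivative_pos_pow32] refl | simp)+
  qed (use assms in auto)
  moreover have "AE u in lborel. indicator {0..t} u *\<^sub>R ((t - u) powr (1 / 2) * indicator {a..<b} u)
       = sqrt (max 0 (t - u)) * indicator {a..b} u"
    using AE_lborel_singleton[of b]
    by eventually_elim (use assms in \<open>auto simp: indicator_def powr_half_sqrt max_def split: if_splits\<close>)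
  ultimately show ?thesis
    by (subst has_bochner_integral_cong_AE[where g = "\<lambda>u. sqrt (max 0 (t - u)) * indicator {a..b} u"])
       (auto simp: algebra_simps)
qed

lemma series_fun_Haar:
  "series_fun (Haar j k) t =
     2 powr (real j / 2) / Gamma (5 / 2) * second_diff (1 / 2 ^ (j + 1)) (t - real k / 2 ^ j)"
proof -
  define a b c :: real where "a = real (2 * k) / 2 ^ (j + 1)"
    and "b = real (2 * k + 1) / 2 ^ (j + 1)" and "c = real (2 * k + 2) / 2 ^ (j + 1)"
  have abc: "0 \<le> a" "a \<le> b" "b \<le> c" by (auto simp: a_def b_def c_def field_simps)
  have "has_bochner_integral lborel
     (\<lambda>u. 2 powr (real j / 2) * (indicator {0..t} u *\<^sub>R ((t - u) powr (1 / 2) * indicator {a..<b} u)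
        - indicator {0..t} u *\<^sub>R ((t - u) powr (1 / 2) * indicator {b..<c} u)))
     (2 powr (real j / 2) * (2 / 3 * (pos_pow32 (t - a) - pos_pow32 (t - b))
         - 2 / 3 * (pos_pow32 (t - b) - pos_pow32 (t - c))))"
    using abc by (intro has_bochner_integral_mult_right has_bochner_integral_diff
         has_bochner_integral_sqrt_kernel_Ico) auto
  also have "(\<lambda>u. 2 powr (real j / 2) * (indicator {0..t} u *\<^sub>R ((t - u) powr (1 / 2) * indicator {a..<b} u)
        - indicator {0..t} u *\<^sub>R ((t - u) powr (1 / 2) * indicator {b..<c} u))) =
      (\<lambda>u. indicator {0..t} u *\<^sub>R ((t - u) powr (3 / 2 - 1) * haar j k u))"
    by (auto simp: haar_def a_def b_def c_def fun_eq_iff algebra_simps)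
  finally have I: "(LINT u:{0..t}|lborel. (t - u) powr (3 / 2 - 1) * haar j k u) =
      (2 powr (real j / 2) * (2 / 3 * (pos_pow32 (t - a) - pos_pow32 (t - b))
         - 2 / 3 * (pos_pow32 (t - b) - pos_pow32 (t - c))))"
    unfolding set_lebesgue_integral_def by (rule has_bochner_integral_integral_eq)
  have Ga: "Gamma (5 / 2) = 3 / 2 * (Gamma (3 / 2) :: real)"
    using Gamma_plus1[of "3 / 2 :: real"] nonpos_Ints_nonpos[of "3 / 2 :: real"] by auto
  have abc': "t - a = t - real k / 2 ^ j" "t - b = t - real k / 2 ^ j - 1 / 2 ^ (j + 1)"
     "t - c = t - real k / 2 ^ j - 2 * (1 / 2 ^ (j + 1))"
    by (auto simp: a_def b_def c_def field_simps)
  have "1 / g * (w * (2 / 3 * (p - q) - 2 / 3 * (q - r))) = w / (3 / 2 * g) * (p - 2 * q + r)"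
    for g w p q r :: real
    by (cases "g = 0") (auto simp: field_simps)
  then show ?thesis
    unfolding series_fun.simps RL_integral_def I Ga abc' second_diff_def .
qed

lemma Gamma_five_half_pos: "(Gamma (5 / 2) :: real) > 0"
  by (rule Gamma_real_pos) simp

lemma series_fun_Haar_nonneg: "series_fun (Haar j k) t \<ge> 0"
  unfolding series_fun_Haar
  using second_diff_nonneg Gamma_five_half_pos by (intro mult_nonneg_nonneg) auto

lemma series_fun_Haar_eq_0: "t \<le> real k / 2 ^ j \<Longrightarrow> series_fun (Haar j k) t = 0"
  unfolding series_fun_Haar by (simp add: second_diff_eq_0)

text \<open>
  Only grid points of the mesh of level \<open>j\<close> are considered: there every support that starts to the
  left has been passed completely, as \<open>second_diff_ge\<close> requires.
\<close>

lemma series_fun_Haar_square_ge: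
  assumes "k < m"
  shows "(series_fun (Haar j k) (real m / 2 ^ j))\<^sup>2 \<ge>
    (3 / (16 * Gamma (5 / 2)))\<^sup>2 / ((2 ^ j)\<^sup>2 * real (m - k))"
proof -
  define d :: real where "d = 1 / 2 ^ (j + 1)"
  define l where "l = real (m - k)"
  have l: "l \<ge> 1" using assms by (simp add: l_def)
  have N: "2 powr (real j / 2) = sqrt (2 ^ j)"
    by (simp add: powr_half_sqrt[symmetric] powr_realpow[symmetric] powr_powr)
  have x: "real m / 2 ^ j - real k / 2 ^ j = 2 * d * l"
    using assms by (simp add: d_def l_def of_nat_diff diff_divide_distrib)
  have d: "d > 0" by (simp add: d_def)
  have "3 / 4 * d\<^sup>2 / sqrt (2 * d * l) \<le> second_diff d (2 * d * l)"
    using d l by (intro second_diff_ge) auto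
  then have "2 powr (real j / 2) / Gamma (5 / 2) * (3 / 4 * d\<^sup>2 / sqrt (2 * d * l))
     \<le> series_fun (Haar j k) (real m / 2 ^ j)"
    unfolding series_fun_Haar x[unfolded d_def] d_def
    using Gamma_five_half_pos by (intro mult_left_mono) auto
  then have "(2 powr (real j / 2) / Gamma (5 / 2) * (3 / 4 * d\<^sup>2 / sqrt (2 * d * l)))\<^sup>2
     \<le> (series_fun (Haar j k) (real m / 2 ^ j))\<^sup>2"
    using Gamma_five_half_pos d l by (intro power_mono) auto
  also have "(2 powr (real j / 2) / Gamma (5 / 2) * (3 / 4 * d\<^sup>2 / sqrt (2 * d * l)))\<^sup>2
      = (3 / (16 * Gamma (5 / 2)))\<^sup>2 / ((2 ^ j)\<^sup>2 * l)"
    using l Gamma_five_half_pos unfolding N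
    by (simp add: power_mult_distrib power_divide d_def)
       (simp add: field_simps power2_eq_square power4_eq_xxxx)
  finally show ?thesis by (simp add: l_def)
qed

lemma sum_series_fun_Haar_le:
  assumes "t \<le> 1"
  shows "(\<Sum>k<n. series_fun (Haar j k) t) \<le> 3 / (4 * Gamma (5 / 2)) * (1 / sqrt 2) ^ j"
proof -
  define d :: real where "d = 1 / 2 ^ (j + 1)"
  have N: "2 powr (real j / 2) = sqrt 2 ^ j"
    by (simp add: powr_half_sqrt[symmetric] powr_realpow[symmetric] powr_powr)
  have "(\<Sum>k<n. series_fun (Haar j k) t) =
    sqrt 2 ^ j / Gamma (5 / 2) * (\<Sum>k<n. second_diff d (t - 2 * real k * d))"
    unfolding series_fun_Haar N sum_distrib_left by (simp add: d_def)
  also have "\<dots> \<le> sqrt 2 ^ j / Gamma (5 / 2) * (3 / 2 * d)"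
    using assms Gamma_five_half_pos
    by (intro mult_left_mono sum_second_diff_le) (auto simp: d_def)
  also have "\<dots> = 3 / (4 * Gamma (5 / 2)) * (sqrt 2 ^ j / 2 ^ j)"
    by (simp add: d_def)
  also have "sqrt 2 ^ j / 2 ^ j = (1 / sqrt 2) ^ j"
    by (simp add: field_simps power_mult_distrib[symmetric])
  finally show ?thesis .
qed

lemma haar_indices_eq:
  "haar_indices = insert Initial ((\<lambda>(j, k). Haar j k) ` (SIGMA j:UNIV. {..<2 ^ j}))"
  by (force simp: haar_indices_def)

text \<open>
  The functions of level \<open>j\<close> are nonnegative and add up to at most a multiple of \<open>2 powr (- j / 2)\<close>.
\<close>

lemma summable_on_abs_series_fun:
  assumes "t \<le> 1"
  shows "(\<lambda>p. \<bar>series_fun p t\<bar>) summable_on haar_indices"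
proof -
  have "(\<lambda>j. 3 / (4 * Gamma (5 / 2)) * (1 / sqrt 2) ^ j :: real) summable_on UNIV"
    by (intro summable_on_cmult_right summable_on_UNIV_nonneg_real_iff[THEN iffD2] summable_geometric) auto
  then have g: "(\<lambda>j. \<Sum>k<2 ^ j. series_fun (Haar j k) t) summable_on UNIV"
    by (rule summable_on_comparison_test)
       (use sum_series_fun_Haar_le[OF assms] series_fun_Haar_nonneg in \<open>auto intro: sum_nonneg\<close>)
  have "(\<lambda>(j, k). series_fun (Haar j k) t) summable_on (SIGMA j:UNIV. {..<2 ^ j})"
    by (rule summable_on_SigmaI[OF _ g]) (auto intro: has_sum_finite series_fun_Haar_nonneg simp del: series_fun.simps)
  then have "(\<lambda>p. \<bar>series_fun p t\<bar>) summable_on (\<lambda>(j, k). Haar j k) ` (SIGMA j:UNIV. {..<2 ^ j})"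
    by (subst summable_on_reindex)
       (auto simp: inj_on_def o_def case_prod_unfold series_fun_Haar_nonneg simp del: series_fun.simps)
  then show ?thesis unfolding haar_indices_eq by (subst summable_on_insert_iff) auto
qed

section \<open>Anti-concentration and almost sure convergence\<close>

text \<open>
  The density is integrated over one standard deviation to the right of the threshold, where it is at
  least its value at the right end.
\<close>

lemma (in prob_space) normal_upper_tail_ge:
  assumes X: "distributed M lborel X (normal_density 0 s)" and "s > 0" "y \<ge> 0"
  shows "exp (- (y + 1)\<^sup>2 / 2) / sqrt (2 * pi) \<le> prob {\<omega> \<in> space M. X \<omega> \<ge> s * y}"
proof -
  define K where "K = exp (- (y + 1)\<^sup>2 / 2) / sqrt (2 * pi)"
  have K: "K \<ge> 0" by (simp add: K_def)
  have dens: "K / s \<le> normal_density 0 s x" if "s * y \<le> x" "x \<le> s * (y + 1)" for x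
  proof -
    have "0 \<le> x" using that assms by (meson mult_nonneg_nonneg less_imp_le order_trans)
    then have "x\<^sup>2 \<le> (s * (y + 1))\<^sup>2" using that by (intro power_mono) auto
    then have "x\<^sup>2 / (2 * s\<^sup>2) \<le> (y + 1)\<^sup>2 / 2"
      using assms unfolding power_mult_distrib by (simp add: field_simps)
    then have "exp (- (y + 1)\<^sup>2 / 2) \<le> exp (- x\<^sup>2 / (2 * s\<^sup>2))" by simp
    then show ?thesis
      using assms by (simp add: K_def normal_density_def real_sqrt_mult field_simps)
  qed
  have "ennreal K = ennreal (K / s) * emeasure lborel {s * y .. s * (y + 1)}"
    using assms K by (simp add: ennreal_mult[symmetric] algebra_simps)
  also have "\<dots> = (\<integral>\<^sup>+x. ennreal (K / s) * indicator {s * y .. s * (y + 1)} x \<partial>lborel)"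
    by (subst nn_integral_cmult_indicator) auto
  also have "\<dots> \<le> (\<integral>\<^sup>+x. ennreal (normal_density 0 s x) * indicator {s * y ..} x \<partial>lborel)"
    using dens by (intro nn_integral_mono) (auto simp: indicator_def ennreal_leI)
  also have "\<dots> = emeasure M (X -` {s * y ..} \<inter> space M)"
    by (rule distributed_emeasure[OF X, symmetric]) simp
  also have "X -` {s * y ..} \<inter> space M = {\<omega> \<in> space M. X \<omega> \<ge> s * y}" by auto
  finally show ?thesis by (simp add: K_def emeasure_eq_measure)
qed

lemma (in prob_space) normal_lower_tail_ge:
  assumes X: "distributed M lborel X (normal_density 0 s)" and "s > 0" "y \<ge> 0"
  shows "exp (- (y + 1)\<^sup>2 / 2) / sqrt (2 * pi) \<le> prob {\<omega> \<in> space M. X \<omega> \<le> - (s * y)}"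
proof -
  have "distributed M lborel (\<lambda>x. 0 + (-1) * X x) (normal_density (0 + (-1) * 0) (\<bar>-1\<bar> * s))"
    by (rule normal_density_affine) (use assms in auto)
  then have "distributed M lborel (\<lambda>x. - X x) (normal_density 0 s)" by simp
  from normal_upper_tail_ge[OF this assms(2,3)] show ?thesis
    by (simp add: le_minus_iff)
qed

text \<open>
  A shift by \<open>c \<ge> 0\<close> keeps values \<open>\<ge> \<theta>\<close> outside of the interval \<open>(-\<theta>, \<theta>)\<close>, and a shift by \<open>c \<le> 0\<close> keeps
  values \<open>\<le> -\<theta>\<close> outside. Hence, conditionally on \<open>Y\<close>, smallness of \<open>a W + b Y\<close> has probability at most
  \<open>1 - p\<close>, whatever \<open>b Y\<close> is.
\<close>

lemma (in prob_space) prob_small_shifted_le: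
  fixes a :: "'c \<Rightarrow> real"
  assumes ind: "indep_var N Y N' W"
    and [measurable]: "S \<in> sets N" "b \<in> borel_measurable N" "a \<in> borel_measurable N'"
    and up: "p \<le> prob {\<omega> \<in> space M. a (W \<omega>) \<ge> \<theta>}"
    and low: "p \<le> prob {\<omega> \<in> space M. a (W \<omega>) \<le> - \<theta>}"
  shows "prob {\<omega> \<in> space M. Y \<omega> \<in> S \<and> \<bar>a (W \<omega>) + b (Y \<omega>)\<bar> < \<theta>}
       \<le> (1 - p) * prob {\<omega> \<in> space M. Y \<omega> \<in> S}"
proof -
  have Y[measurable]: "random_variable N Y" and W[measurable]: "random_variable N' W"
    and pair: "distr M N Y \<Otimes>\<^sub>M distr M N' W = distr M (N \<Otimes>\<^sub>M N') (\<lambda>\<omega>. (Y \<omega>, W \<omega>))"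
    using ind by (auto simp: indep_var_distribution_eq)
  interpret D: prob_space "distr M N' W" by (rule prob_space_distr) simp
  have p1: "p \<le> 1" using up order_trans prob_le_1 by blast
  have small: "emeasure (distr M N' W) {w \<in> space N'. \<bar>a w + c\<bar> < \<theta>} \<le> ennreal (1 - p)" for c
  proof -
    have "p \<le> prob {\<omega> \<in> space M. \<not> \<bar>a (W \<omega>) + c\<bar> < \<theta>}"
    proof (cases "c \<ge> 0")
      case True
      show ?thesis by (rule order_trans[OF up]) (use True in \<open>auto intro!: finite_measure_mono\<close>)
    next
      case False
      show ?thesis by (rule order_trans[OF low]) (use False in \<open>auto intro!: finite_measure_mono\<close>)
    qed
    then have "prob {\<omega> \<in> space M. \<bar>a (W \<omega>) + c\<bar> < \<theta>} \<le> 1 - p"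
      by (subst (asm) prob_neg) auto
    moreover have "W -` {w \<in> space N'. \<bar>a w + c\<bar> < \<theta>} \<inter> space M = {\<omega> \<in> space M. \<bar>a (W \<omega>) + c\<bar> < \<theta>}"
      using measurable_space[OF W] by auto
    ultimately show ?thesis
      by (simp add: emeasure_distr emeasure_eq_measure ennreal_leI)
  qed
  define T where "T = {z \<in> space (N \<Otimes>\<^sub>M N'). fst z \<in> S \<and> \<bar>a (snd z) + b (fst z)\<bar> < \<theta>}"
  have T[measurable]: "T \<in> sets (N \<Otimes>\<^sub>M N')" unfolding T_def by measurable
  have "emeasure M {\<omega> \<in> space M. Y \<omega> \<in> S \<and> \<bar>a (W \<omega>) + b (Y \<omega>)\<bar> < \<theta>} =
      emeasure (distr M (N \<Otimes>\<^sub>M N') (\<lambda>\<omega>. (Y \<omega>, W \<omega>))) T"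
    by (subst emeasure_distr)
       (auto simp: T_def space_pair_measure intro!: arg_cong[where f = "emeasure M"]
        dest: measurable_space[OF Y] measurable_space[OF W])
  also have "\<dots> = emeasure (distr M N Y \<Otimes>\<^sub>M distr M N' W) T"
    by (simp add: pair)
  also have "\<dots> = (\<integral>\<^sup>+y. emeasure (distr M N' W) (Pair y -` T) \<partial>distr M N Y)"
    by (rule D.emeasure_pair_measure_alt) simp
  also have "\<dots> \<le> (\<integral>\<^sup>+y. ennreal (1 - p) * indicator S y \<partial>distr M N Y)"
  proof (rule nn_integral_mono)
    fix y assume "y \<in> space (distr M N Y)"
    then have "Pair y -` T = (if y \<in> S then {w \<in> space N'. \<bar>a w + b y\<bar> < \<theta>} else {})"
      by (auto simp: T_def space_pair_measure)
    then show "emeasure (distr M N' W) (Pair y -` T) \<le> ennreal (1 - p) * indicator S y"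
      using small[of "b y"] by simp
  qed
  also have "\<dots> = ennreal (1 - p) * emeasure M (Y -` S \<inter> space M)"
    by (subst nn_integral_cmult_indicator) (auto simp: emeasure_distr)
  also have "Y -` S \<inter> space M = {\<omega> \<in> space M. Y \<omega> \<in> S}" by auto
  finally show ?thesis using p1 by (simp add: emeasure_eq_measure ennreal_mult[symmetric])
qed

text \<open>
  The blocks are revealed one after the other. \<open>G q\<close> indexes what is known before block \<open>q\<close>, and \<open>V q\<close>
  the fresh coefficients of that block. Given the past, each block in \<open>Q\<close> contributes a factor
  \<open>1 - p\<close>. Blocks outside of \<open>Q\<close> are passed over, which avoids renumbering the good ones.
\<close>

lemma (in prob_space) prob_all_small_le:
  fixes \<xi> :: "'i \<Rightarrow> 'a \<Rightarrow> real" and a b :: "nat \<Rightarrow> ('i \<Rightarrow> real) \<Rightarrow> real"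
  assumes ind: "indep_vars (\<lambda>_. borel) \<xi> I"
    and G: "\<And>q. q < r \<Longrightarrow> G q \<union> V q \<subseteq> G (Suc q)" "\<And>q. q < r \<Longrightarrow> G q \<inter> V q = {}"
      "\<And>q. q \<le> r \<Longrightarrow> G q \<subseteq> I"
    and a: "\<And>q. q < r \<Longrightarrow> a q \<in> borel_measurable (PiM (V q) (\<lambda>_. borel))"
    and b: "\<And>q. q < r \<Longrightarrow> b q \<in> borel_measurable (PiM (G q) (\<lambda>_. borel))"
    and up: "\<And>q. q < r \<Longrightarrow> q \<in> Q \<Longrightarrow> p \<le> prob {\<omega> \<in> space M. a q (\<lambda>i\<in>V q. \<xi> i \<omega>) \<ge> \<theta>}"
    and low: "\<And>q. q < r \<Longrightarrow> q \<in> Q \<Longrightarrow> p \<le> prob {\<omega> \<in> space M. a q (\<lambda>i\<in>V q. \<xi> i \<omega>) \<le> - \<theta>}"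
  shows "prob {\<omega> \<in> space M. \<forall>q<r. q \<in> Q \<longrightarrow>
            \<bar>a q (\<lambda>i\<in>V q. \<xi> i \<omega>) + b q (\<lambda>i\<in>G q. \<xi> i \<omega>)\<bar> < \<theta>} \<le> (1 - p) ^ card (Q \<inter> {..<r})"
    (is "prob (?E r) \<le> _")
  using assms
proof (induction r)
  case 0
  then show ?case by simp
next
  case (Suc r)
  have IH: "prob (?E r) \<le> (1 - p) ^ card (Q \<inter> {..<r})"
    using Suc.prems by (intro Suc.IH) auto
  have \<xi>[measurable]: "random_variable borel (\<xi> i)" if "i \<in> I" for i
    using ind that by (auto simp: indep_vars_def)
  have Gmono: "G q \<union> V q \<subseteq> G r" if "q < r" for q
  proof -
    have "G (Suc q) \<subseteq> G (Suc q + d)" if "Suc q + d \<le> Suc r" for d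
      using that Suc.prems(2) by (induction d) (auto, force)
    from this[of "r - Suc q"] that Suc.prems(2)[of q] show ?thesis by auto
  qed
  show ?case
  proof (cases "r \<in> Q")
    case False
    then have "?E (Suc r) = ?E r" by (auto simp: less_Suc_eq)
    moreover have "Q \<inter> {..<Suc r} = Q \<inter> {..<r}" using False by (auto simp: less_Suc_eq)
    ultimately show ?thesis using IH by simp
  next
    case True
    define S where "S = {y \<in> space (PiM (G r) (\<lambda>_. borel)). \<forall>q\<in>{..<r}. q \<in> Q \<longrightarrow>
       \<bar>a q (restrict y (V q)) + b q (restrict y (G q))\<bar> < \<theta>}"
    have S: "S \<in> sets (PiM (G r) (\<lambda>_. borel))"
    proof -
      have meas: "(\<lambda>y. a q (restrict y (V q)) + b q (restrict y (G q))) \<in> borel_measurable (PiM (G r) (\<lambda>_. borel))"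
        if "q < r" for q
      proof -
        have "(\<lambda>y. restrict y (V q)) \<in> measurable (PiM (G r) (\<lambda>_. borel)) (PiM (V q) (\<lambda>_. borel :: real measure))"
          "(\<lambda>y. restrict y (G q)) \<in> measurable (PiM (G r) (\<lambda>_. borel)) (PiM (G q) (\<lambda>_. borel :: real measure))"
          using Gmono[OF that] by (auto intro!: measurable_restrict_subset)
        from measurable_compose[OF this(1) Suc.prems(5)[of q]] measurable_compose[OF this(2) Suc.prems(6)[of q]] that
        show ?thesis by (intro borel_measurable_add) (simp_all only: less_Suc_eq simp_thms)
      qed
      have "{y \<in> space (PiM (G r) (\<lambda>_. borel)). q \<in> Q \<longrightarrow>
         \<bar>a q (restrict y (V q)) + b q (restrict y (G q))\<bar> < \<theta>} \<in> sets (PiM (G r) (\<lambda>_. borel))"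
        if "q < r" for q
        using meas[OF that] by (cases "q \<in> Q") auto
      then show ?thesis unfolding S_def by (intro sets.sets_Collect_finite_All) auto
    qed
    have ind2: "indep_var (PiM (G r) (\<lambda>_. borel)) (\<lambda>\<omega>. \<lambda>i\<in>G r. \<xi> i \<omega>)
        (PiM (V r) (\<lambda>_. borel)) (\<lambda>\<omega>. \<lambda>i\<in>V r. \<xi> i \<omega>)"
      using Suc.prems(2)[of r] Suc.prems(3)[of r] Suc.prems(4)[of "Suc r"]
      by (intro indep_var_restrict[OF ind]) auto
    have inS: "(\<lambda>i\<in>G r. \<xi> i \<omega>) \<in> S \<longleftrightarrow> \<omega> \<in> ?E r" if "\<omega> \<in> space M" for \<omega>
    proof -
      have *: "G r \<inter> V q = V q" "G r \<inter> G q = G q" if "q < r" for q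
        using Gmono[OF that] by auto
      have "(\<lambda>i\<in>G r. \<xi> i \<omega>) \<in> space (PiM (G r) (\<lambda>_. borel))" by (auto simp: space_PiM)
      with that show ?thesis unfolding S_def by (auto simp: * simp del: restrict_apply)
    qed
    have "?E (Suc r) = {\<omega> \<in> space M. (\<lambda>i\<in>G r. \<xi> i \<omega>) \<in> S \<and>
       \<bar>a r (\<lambda>i\<in>V r. \<xi> i \<omega>) + b r (\<lambda>i\<in>G r. \<xi> i \<omega>)\<bar> < \<theta>}"
      using inS True by (auto simp: less_Suc_eq simp del: restrict_apply)
    also have "prob \<dots> \<le> (1 - p) * prob {\<omega> \<in> space M. (\<lambda>i\<in>G r. \<xi> i \<omega>) \<in> S}"
      using Suc.prems True by (intro prob_small_shifted_le[OF ind2 S]) auto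
    also have "{\<omega> \<in> space M. (\<lambda>i\<in>G r. \<xi> i \<omega>) \<in> S} = ?E r"
      using inS by (auto simp del: restrict_apply)
    also have "(1 - p) * prob (?E r) \<le> (1 - p) * (1 - p) ^ card (Q \<inter> {..<r})"
      using IH order_trans[OF Suc.prems(7)[of r] prob_le_1] True by (intro mult_left_mono) auto
    also have "\<dots> = (1 - p) ^ card (Q \<inter> {..<Suc r})"
    proof -
      have "Q \<inter> {..<Suc r} = insert r (Q \<inter> {..<r})" using True by (auto simp: less_Suc_eq)
      then show ?thesis by simp
    qed
    finally show ?thesis .
  qed
qed

lemma summable_abs_series_fun:
  assumes "bij_betw \<sigma> {1..} haar_indices" "n \<ge> 1" "t \<le> 1"
  shows "summable (\<lambda>i. \<bar>series_fun (\<sigma> (n + i)) t\<bar>)"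
proof -
  have inj: "inj (\<lambda>i. \<sigma> (n + i))"
    using assms(1,2) by (auto intro!: injI dest!: bij_betw_imp_inj_on inj_onD)
  have "range (\<lambda>i. \<sigma> (n + i)) \<subseteq> haar_indices"
    using assms(1,2) by (auto simp: bij_betw_def)
  then have "(\<lambda>p. \<bar>series_fun p t\<bar>) summable_on range (\<lambda>i. \<sigma> (n + i))"
    using summable_on_abs_series_fun[OF assms(3)] summable_on_subset_banach by blast
  then show ?thesis
    by (subst (asm) summable_on_reindex[OF inj]) (auto intro: summable_on_imp_summable simp: o_def)
qed

text \<open>
  The sum of the absolute values has finite expectation, by monotone convergence and the finite
  first absolute moment of the normal distribution.
\<close>

lemma (in prob_space) AE_summable_random_series:
  assumes norm: "\<And>i::nat. distributed M lborel (X i) std_normal_density"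
    and c: "summable (\<lambda>i. \<bar>c i\<bar>)"
  shows "AE \<omega> in M. summable (\<lambda>i. X i \<omega> * c i)"
proof -
  have [measurable]: "random_variable borel (X i)" for i
    using distributed_measurable[OF norm] by simp
  define K where "K = (\<integral>\<^sup>+x. ennreal (std_normal_density x * \<bar>x\<bar>) \<partial>lborel)"
  have K: "K \<noteq> top"
    using integrable_std_normal_moment_abs[of 1]
    by (auto simp: K_def integrable_iff_bounded abs_mult top.not_eq_extremum)
  have E: "(\<integral>\<^sup>+\<omega>. ennreal \<bar>X i \<omega> * c i\<bar> \<partial>M) = K * ennreal \<bar>c i\<bar>" for i
  proof -
    have "(\<integral>\<^sup>+\<omega>. ennreal \<bar>X i \<omega>\<bar> \<partial>M) = K"
      using distributed_nn_integral[OF norm, of "\<lambda>x. ennreal \<bar>x\<bar>" i]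
      by (simp add: K_def ennreal_mult)
    then show ?thesis
      by (simp add: abs_mult ennreal_mult nn_integral_multc)
  qed
  have "(\<integral>\<^sup>+\<omega>. (\<Sum>i. ennreal \<bar>X i \<omega> * c i\<bar>) \<partial>M) = K * (\<Sum>i. ennreal \<bar>c i\<bar>)"
    by (simp add: nn_integral_suminf E)
  also have "\<dots> \<noteq> top"
    using K c by (simp add: ennreal_mult_eq_top_iff suminf_ennreal2)
  finally have "AE \<omega> in M. (\<Sum>i. ennreal \<bar>X i \<omega> * c i\<bar>) \<noteq> top"
    by (intro nn_integral_PInf_AE[unfolded infinity_ennreal_def]) auto
  then show ?thesis
  proof eventually_elim
    case (elim \<omega>)
    then have "summable (\<lambda>i. \<bar>X i \<omega> * c i\<bar>)" by (intro summable_suminf_not_top) auto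
    then show ?case by (rule summable_rabs_cancel)
  qed
qed

text \<open>
  The finite part \<open>V\<close> is subtracted from the whole series, so that its summability is the only
  analytic input. The remainder is kept as a series over the enumeration, which makes it a
  measurable function of the coefficients indexed by \<open>G\<close>.
\<close>

lemma series_tail_split:
  assumes sm: "summable (\<lambda>i. x (s (n + i)) * series_fun (s (n + i)) t)"
    and inj: "inj_on s {n..}" and V: "finite V" "V \<subseteq> s ` {n..}" "V \<inter> G = {}"
    and cover: "\<And>p. p \<in> s ` {n..} \<Longrightarrow> p \<notin> V \<Longrightarrow> p \<notin> G \<Longrightarrow> series_fun p t = 0"
  shows "series_tail x s n t = (\<Sum>p\<in>V. x p * series_fun p t) +
     (\<Sum>i. if s (n + i) \<in> G then x (s (n + i)) * series_fun (s (n + i)) t else 0)"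
proof -
  define f where "f i = x (s (n + i)) * series_fun (s (n + i)) t" for i
  define J where "J = {i. s (n + i) \<in> V}"
  have bij: "bij_betw (\<lambda>i. s (n + i)) J V"
    unfolding bij_betw_def
  proof
    show "inj_on (\<lambda>i. s (n + i)) J" using inj by (auto intro!: inj_onI dest!: inj_onD)
    show "(\<lambda>i. s (n + i)) ` J = V"
    proof (intro equalityI subsetI)
      fix p assume "p \<in> V"
      then obtain m where "m \<ge> n" "p = s m" using V by auto
      then show "p \<in> (\<lambda>i. s (n + i)) ` J" using \<open>p \<in> V\<close>
        by (intro image_eqI[of _ _ "m - n"]) (auto simp: J_def)
    qed (auto simp: J_def)
  qed
  have fin: "finite J" using bij_betw_finite[OF bij] V by simp
  have sumV: "(\<lambda>i. if i \<in> J then f i else 0) sums (\<Sum>p\<in>V. x p * series_fun p t)"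
    using sums_If_finite_set[OF fin, of f] sum.reindex_bij_betw[OF bij, of "\<lambda>p. x p * series_fun p t"]
    by (simp add: f_def)
  have "(\<lambda>i. if s (n + i) \<in> G then f i else 0) = (\<lambda>i. f i - (if i \<in> J then f i else 0))"
    using V(3) cover by (auto simp: J_def f_def fun_eq_iff)
  moreover have "(\<lambda>i. f i - (if i \<in> J then f i else 0)) sums (suminf f - (\<Sum>p\<in>V. x p * series_fun p t))"
    by (intro sums_diff sumV summable_sums) (use sm in \<open>simp add: f_def\<close>)
  ultimately have "(\<Sum>i. if s (n + i) \<in> G then f i else 0) = suminf f - (\<Sum>p\<in>V. x p * series_fun p t)"
    by (simp only: sums_iff)
  then show ?thesis unfolding series_tail_def f_def by linarith
qed

section \<open>Harmonic sums surviving a sparse deletion\<close>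

lemma sum_inverse_distance_left: "(\<Sum>k\<in>{m..<m + L}. 1 / real (m + L - k)) = harm L"
  unfolding harm_def
  by (rule sum.reindex_bij_witness[of _ "\<lambda>l. m + L - l" "\<lambda>k. m + L - k"]) (auto simp: field_simps)

lemma sum_inverse_distance_right: "(\<Sum>m\<in>{k<..k + L}. 1 / real (m - k)) = harm L"
  unfolding harm_def
  by (rule sum.reindex_bij_witness[of _ "\<lambda>l. k + l" "\<lambda>m. m - k"]) (auto simp: field_simps)

text \<open>
  An adversary who deletes few indices can destroy the harmonic sum to the left of a given point, by
  deleting its nearest neighbours, but not to the left of every point: a deleted \<open>k\<close> takes at most \<open>harm L\<close>
  from the sums of all points \<open>m\<close> together. So on average over the \<open>L\<close> points in the right half of
  the block the loss is at most half of \<open>harm L\<close>. Windows of length \<open>L\<close> ending in the right half stay in the block.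
\<close>

lemma exists_large_harmonic_window:
  fixes Z :: "nat set"
  assumes "L > 0" and few: "2 * card (Z \<inter> {s..<s + 2 * L}) \<le> L"
  shows "\<exists>m\<in>{s + L<..s + 2 * L}. harm L / 2 \<le> (\<Sum>k\<in>{m - L..<m} - Z. 1 / real (m - k))"
proof (rule ccontr)
  assume "\<not> ?thesis"
  then have small: "(\<Sum>k\<in>{m - L..<m} - Z. 1 / real (m - k)) < harm L / 2"
    if "m \<in> {s + L<..s + 2 * L}" for m using that by force
  \<comment> \<open>the part of the harmonic sum at \<open>m\<close> that the deletions remove\<close>
  define B where "B m = (\<Sum>k\<in>Z \<inter> {s..<s + 2 * L}. if k < m \<and> m \<le> k + L then 1 / real (m - k) else 0)" for m
  have B: "harm L / 2 < B m" if m: "m \<in> {s + L<..s + 2 * L}" for m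
  proof -
    have "harm L = (\<Sum>k\<in>{m - L..<m}. 1 / real (m - k))"
      using sum_inverse_distance_left[of "m - L" L] m by auto
    also have "\<dots> = (\<Sum>k\<in>{m - L..<m} - Z. 1 / real (m - k)) + (\<Sum>k\<in>{m - L..<m} \<inter> Z. 1 / real (m - k))"
      by (subst sum.Int_Diff[of _ _ Z]) auto
    also have "(\<Sum>k\<in>{m - L..<m} \<inter> Z. 1 / real (m - k)) = B m"
      unfolding B_def
      by (subst sum.inter_filter[symmetric]) (use m in \<open>auto intro!: sum.cong\<close>)
    finally show ?thesis using small[OF m] by simp
  qed
  have "real L * (harm L / 2) < (\<Sum>m\<in>{s + L<..s + 2 * L}. B m)"
    using sum_strict_mono[of "{s + L<..s + 2 * L}" "\<lambda>_. harm L / 2" B] B assms(1) by simp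
  also have "\<dots> = (\<Sum>k\<in>Z \<inter> {s..<s + 2 * L}. \<Sum>m\<in>{s + L<..s + 2 * L}.
      if k < m \<and> m \<le> k + L then 1 / real (m - k) else 0)"
    unfolding B_def by (rule sum.swap)
  also have "\<dots> \<le> (\<Sum>k\<in>Z \<inter> {s..<s + 2 * L}. harm L)"
  proof (rule sum_mono)
    fix k
    have "(\<Sum>m\<in>{s + L<..s + 2 * L}. if k < m \<and> m \<le> k + L then 1 / real (m - k) else 0) =
      (\<Sum>m\<in>{m\<in>{s + L<..s + 2 * L}. k < m \<and> m \<le> k + L}. 1 / real (m - k))"
      by (rule sum.inter_filter[symmetric]) simp
    also have "\<dots> \<le> (\<Sum>m\<in>{k<..k + L}. 1 / real (m - k))"
      by (rule sum_mono2) auto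
    finally show "(\<Sum>m\<in>{s + L<..s + 2 * L}. if k < m \<and> m \<le> k + L then 1 / real (m - k) else 0) \<le> harm L"
      unfolding sum_inverse_distance_right .
  qed
  also have "\<dots> = real (card (Z \<inter> {s..<s + 2 * L})) * harm L" by simp
  also have "\<dots> \<le> real L / 2 * harm L"
    using few harm_nonneg[where 'a = real] by (intro mult_right_mono) linarith+
  finally show False by simp
qed

lemma card_light_blocks_ge:
  fixes Z :: "nat set"
  assumes "L > 0" "finite Z" "4 * card Z \<le> R * L"
  shows "R \<le> 2 * card {q. q < R \<and> 2 * card (Z \<inter> {2 * q * L..<2 * q * L + 2 * L}) \<le> L}"
proof -
  define S where "S q = Z \<inter> {2 * q * L..<2 * q * L + 2 * L}" for q
  define H where "H = {q. q < R \<and> L < 2 * card (S q)}"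
  have fin: "finite H" by (simp add: H_def)
  have disj: "S q \<inter> S q' = {}" if "q < q'" for q q'
  proof -
    have "2 * q * L + 2 * L \<le> 2 * q' * L"
      using mult_right_mono[of "Suc q" q' "2 * L"] that by (simp add: algebra_simps)
    then show ?thesis by (auto simp: S_def)
  qed
  have "card H * L \<le> (\<Sum>q\<in>H. 2 * card (S q))"
    using sum_mono[of H "\<lambda>_. L" "\<lambda>q. 2 * card (S q)"] by (auto simp: H_def)
  also have "\<dots> = 2 * card (\<Union>q\<in>H. S q)"
  proof -
    have "card (\<Union>q\<in>H. S q) = (\<Sum>q\<in>H. card (S q))"
    proof (rule card_UN_disjoint)
      show "\<forall>i\<in>H. \<forall>j\<in>H. i \<noteq> j \<longrightarrow> S i \<inter> S j = {}"
        using disj by (metis inf_commute linorder_neqE_nat)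
    qed (use fin assms in \<open>auto simp: S_def\<close>)
    then show ?thesis by (simp add: sum_distrib_left)
  qed
  also have "\<dots> \<le> 2 * card Z"
    using assms(2) by (intro mult_le_mono card_mono) (auto simp: S_def)
  finally have "(2 * card H) * L \<le> R * L" using assms(3) by linarith
  then have "2 * card H \<le> R" using assms(1) unfolding mult_le_cancel2 by blast
  moreover have "card {q. q < R \<and> 2 * card (S q) \<le> L} + card H = R"
    by (subst card_Un_disjoint[symmetric])
       (auto simp: H_def intro!: arg_cong[where f = card and y = "{..<R}", simplified])
  ultimately show ?thesis by (simp add: S_def)
qed

section \<open>The lower bound\<close>

text \<open>
  The bound at one level. The hypothesis \<open>8 * n \<le> 2 ^ j\<close> guarantees that most of level \<open>j\<close>
  is still in the tail. The condition on the size of \<open>j\<close> makes the number of light blocks, about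
  \<open>exp (j * ln 2 / 2)\<close>, outweigh the Gaussian tail probability \<open>exp (- j / 4)\<close> of a single block.
\<close>

lemma (in prob_space) expected_norm_series_tail_ge:
  fixes \<xi> :: "haar_index \<Rightarrow> 'a \<Rightarrow> real" and \<sigma> :: "nat \<Rightarrow> haar_index"
  assumes ind: "indep_vars (\<lambda>_. borel) \<xi> haar_indices"
    and norm: "\<And>p. p \<in> haar_indices \<Longrightarrow> distributed M lborel (\<xi> p) std_normal_density"
    and bij: "bij_betw \<sigma> {1..} haar_indices"
    and n: "n \<ge> 1" "8 * n \<le> 2 ^ j" and large: "48 * sqrt (2 * pi) \<le> real j"
  shows "ennreal (3 / (16 * Gamma (5 / 2)) / 16 * real j / 2 ^ j)
      \<le> (\<integral>\<^sup>+\<omega>. unif_norm (series_tail (\<lambda>p. \<xi> p \<omega>) \<sigma> n) \<partial>M)"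
proof -
  define c :: real where "c = 3 / (16 * Gamma (5 / 2))"
  have c: "c > 0" using Gamma_five_half_pos by (simp add: c_def)
  have "sqrt (2 * pi) \<ge> 1" using pi_gt3 by simp
  with large have j: "j \<ge> 2" by linarith
  \<comment> \<open>\<open>R\<close> blocks of \<open>2 * L\<close> indices each, with \<open>L\<close> a power of two near \<open>sqrt (2 ^ j)\<close>: then \<open>ln L\<close> and
     \<open>ln R\<close> are both of order \<open>j\<close>, as the variance and the number of points require\<close>
  define L R :: nat where "L = 2 ^ (j div 2)" and "R = 2 ^ (j - j div 2 - 1)"
  have L: "L > 0" by (simp add: L_def)
  have LR: "2 * R * L = 2 ^ j"
  proof -
    have "2 * R * L = 2 ^ (Suc (j - j div 2 - 1) + j div 2)"
      by (simp only: R_def L_def power_add power_Suc)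
    also have "Suc (j - j div 2 - 1) + j div 2 = j" using j by simp
    finally show ?thesis .
  qed
  \<comment> \<open>the positions of level \<open>j\<close> that the tail lacks\<close>
  define Z where "Z = {k. Haar j k \<in> \<sigma> ` {1..<n}}"
  have ZI: "Haar j ` Z \<subseteq> \<sigma> ` {1..<n}" by (auto simp: Z_def)
  have "finite (Haar j ` Z)" by (rule finite_subset[OF ZI]) simp
  then have finZ: "finite Z" by (rule finite_imageD) (auto simp: inj_on_def)
  have "card Z = card (Haar j ` Z)" by (rule card_image[symmetric]) (auto simp: inj_on_def)
  also have "\<dots> \<le> card (\<sigma> ` {1..<n})" by (rule card_mono[OF _ ZI]) simp
  also have "\<dots> \<le> n" using card_image_le[of "{1..<n}" \<sigma>] by simp
  finally have cardZ: "4 * card Z \<le> R * L" using n LR by linarith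
  define Q where "Q = {q. q < R \<and> 2 * card (Z \<inter> {2 * q * L..<2 * q * L + 2 * L}) \<le> L}"
  have cardQ: "R \<le> 2 * card Q" unfolding Q_def by (rule card_light_blocks_ge[OF L finZ cardZ])
  have "\<exists>m\<in>{2 * q * L + L<..2 * q * L + 2 * L}. q \<in> Q \<longrightarrow>
     harm L / 2 \<le> (\<Sum>k\<in>{m - L..<m} - Z. 1 / real (m - k))" for q
  proof (cases "q \<in> Q")
    case True
    then show ?thesis using exists_large_harmonic_window[OF L, of Z "2 * q * L"] by (auto simp: Q_def)
  next
    case False
    then show ?thesis using L by (intro bexI[of _ "2 * q * L + 2 * L"]) auto
  qed
  then obtain m where m: "\<And>q. m q \<in> {2 * q * L + L<..2 * q * L + 2 * L}"
    and mQ: "\<And>q. q \<in> Q \<Longrightarrow> harm L / 2 \<le> (\<Sum>k\<in>{m q - L..<m q} - Z. 1 / real (m q - k))"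
    by metis
  have mN: "m q \<le> 2 ^ j" if "q < R" for q
    using mult_right_mono[of "Suc q" R "2 * L"] m[of q] LR that by (simp add: algebra_simps)
  define t where "t q = real (m q) / 2 ^ j" for q
  have t: "t q \<in> {0..1}" if "q < R" for q
    using mN[OF that] by (simp add: t_def divide_le_eq)
  \<comment> \<open>\<open>V q\<close> has all surviving indices of block \<open>q\<close> that are felt at \<open>t q\<close>. \<open>G q\<close> drops everything of level
     \<open>j\<close> from block \<open>q\<close> on: the functions with index at least \<open>m q\<close> vanish at \<open>t q\<close>,
     so \<open>V q\<close> and \<open>G q\<close> together determine the tail at \<open>t q\<close>\<close>
  define V where "V q = Haar j ` ({2 * q * L..<m q} - Z)" for q
  define G where "G q = haar_indices - Haar j ` {2 * q * L..}" for q
  define a where "a q y = (\<Sum>p\<in>V q. y p * series_fun p (t q))" for q and y :: "haar_index \<Rightarrow> real"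
  define b where "b q y = (\<Sum>i. if \<sigma> (n + i) \<in> G q then y (\<sigma> (n + i)) * series_fun (\<sigma> (n + i)) (t q) else 0)"
    for q and y :: "haar_index \<Rightarrow> real"
  have VI: "V q \<subseteq> haar_indices" if "q < R" for q
    using mN[OF that] by (auto simp: V_def haar_indices_def)
  have finV: "finite (V q)" for q by (simp add: V_def)
  have G_step: "G q \<union> V q \<subseteq> G (Suc q)" if "q < R" for q
    using VI[OF that] m[of q] by (auto simp: G_def V_def)
  have GI: "G q \<subseteq> haar_indices" for q by (auto simp: G_def)
  have GV: "G q \<inter> V q = {}" for q by (auto simp: G_def V_def)
  have \<xi>[measurable]: "random_variable borel (\<xi> p)" if "p \<in> haar_indices" for p
    using ind that by (auto simp: indep_vars_def)
  have a_meas: "a q \<in> borel_measurable (PiM (V q) (\<lambda>_. borel))" for q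
    unfolding a_def by measurable
  have b_meas: "b q \<in> borel_measurable (PiM (G q) (\<lambda>_. borel))" for q
    unfolding b_def
  proof (intro borel_measurable_suminf)
    fix i
    show "(\<lambda>y. if \<sigma> (n + i) \<in> G q then y (\<sigma> (n + i)) * series_fun (\<sigma> (n + i)) (t q) else 0)
        \<in> borel_measurable (PiM (G q) (\<lambda>_. borel))"
      by (cases "\<sigma> (n + i) \<in> G q") auto
  qed
  \<comment> \<open>\<open>c * sqrt j / (4 * 2 ^ j)\<close> is a lower bound for the standard deviation of a block, and \<open>\<theta>\<close> is \<open>y\<close> times
     that. The factor in \<open>y\<close> keeps \<open>y\<^sup>2 = j / 4\<close>, which bounds the exponent of the tail probability up to a
     constant, below the growth exponent \<open>j * ln 2 / 2\<close> of the number of blocks\<close>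
  define \<theta> where "\<theta> = c * real j / (8 * 2 ^ j)"
  define y where "y = sqrt (real j) / 2"
  define \<rho> where "\<rho> = exp (- (y + 1)\<^sup>2 / 2) / sqrt (2 * pi)"
  have a_restrict: "a q (\<lambda>i\<in>V q. \<xi> i \<omega>) = (\<Sum>p\<in>V q. \<xi> p \<omega> * series_fun p (t q))" for q \<omega>
    by (auto simp: a_def intro!: sum.cong)
  have b_restrict: "b q (\<lambda>i\<in>G q. \<xi> i \<omega>) = b q (\<lambda>p. \<xi> p \<omega>)" for q \<omega>
    unfolding b_def by (intro suminf_cong) auto
  have tails: "\<rho> \<le> prob {\<omega> \<in> space M. a q (\<lambda>i\<in>V q. \<xi> i \<omega>) \<ge> \<theta>}"
    "\<rho> \<le> prob {\<omega> \<in> space M. a q (\<lambda>i\<in>V q. \<xi> i \<omega>) \<le> - \<theta>}" if q: "q \<in> Q" for q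
  proof -
    have qR: "q < R" using q by (simp add: Q_def)
    \<comment> \<open>the standard deviation of the block; the factor \<open>1\<close> is that of a single coefficient\<close>
    define s where "s = sqrt (\<Sum>p\<in>V q. (\<bar>series_fun p (t q)\<bar> * 1)\<^sup>2)"
    have sq: "c\<^sup>2 / (2 ^ j)\<^sup>2 * (1 / real (m q - k)) \<le> (series_fun (Haar j k) (t q))\<^sup>2" if "k < m q" for k
      using series_fun_Haar_square_ge[OF that, of j] by (simp add: c_def t_def)
    have nz: "series_fun p (t q) \<noteq> 0" if pV: "p \<in> V q" for p
    proof -
      obtain k where k: "p = Haar j k" "k < m q" using pV by (auto simp: V_def)
      have "0 < c\<^sup>2 / (2 ^ j)\<^sup>2 * (1 / real (m q - k))"
        using c k by (intro mult_pos_pos divide_pos_pos) auto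
      also have "\<dots> \<le> (series_fun p (t q))\<^sup>2" using sq k by blast
      finally show ?thesis unfolding zero_less_power2 .
    qed
    have harmL: "harm L \<ge> real j / 8"
    proof -
      have "real j / 8 \<le> real (j div 2) * ln 2"
      proof -
        have "real j / 4 \<le> real (j div 2)" using j by linarith
        moreover have "1 / 2 \<le> ln (2 :: real)"
          using ln2_ge_two_thirds by simp
        ultimately have "real j / 4 * (1 / 2) \<le> real (j div 2) * ln 2" by (intro mult_mono) auto
        then show ?thesis by simp
      qed
      also have "\<dots> = ln (real L)" by (simp add: L_def ln_realpow)
      also have "\<dots> \<le> ln (real L + 1)" using L by simp
      also have "\<dots> \<le> harm L" by (rule ln_le_harm)
      finally show ?thesis .
    qed
    have "(c * sqrt (real j) / (4 * 2 ^ j))\<^sup>2 = c\<^sup>2 / (2 ^ j)\<^sup>2 * (real j / 16)"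
      by (simp add: power_mult_distrib power_divide)
    also have "\<dots> \<le> c\<^sup>2 / (2 ^ j)\<^sup>2 * (\<Sum>k\<in>{m q - L..<m q} - Z. 1 / real (m q - k))"
      using harmL mQ[OF q] by (intro mult_left_mono) auto
    also have "\<dots> \<le> (\<Sum>k\<in>{m q - L..<m q} - Z. (series_fun (Haar j k) (t q))\<^sup>2)"
      unfolding sum_distrib_left by (intro sum_mono sq) auto
    also have "\<dots> \<le> (\<Sum>k\<in>{2 * q * L..<m q} - Z. (series_fun (Haar j k) (t q))\<^sup>2)"
      using m[of q] by (intro sum_mono2) auto
    also have "\<dots> = (\<Sum>p\<in>V q. (\<bar>series_fun p (t q)\<bar> * 1)\<^sup>2)"
      unfolding V_def by (subst sum.reindex) (auto simp: inj_on_def)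
    finally have s2: "(c * sqrt (real j) / (4 * 2 ^ j))\<^sup>2 \<le> (\<Sum>p\<in>V q. (\<bar>series_fun p (t q)\<bar> * 1)\<^sup>2)" .
    then have s: "c * sqrt (real j) / (4 * 2 ^ j) \<le> s"
      unfolding s_def by (rule real_le_rsqrt)
    have "0 < c * sqrt (real j) / (4 * 2 ^ j)" using c j by simp
    with s have s_pos: "s > 0" by linarith
    then have Vne: "V q \<noteq> {}" by (auto simp: s_def)
    have "distributed M lborel (\<lambda>\<omega>. \<Sum>p\<in>V q. series_fun p (t q) * \<xi> p \<omega>) (normal_density (\<Sum>p\<in>V q. 0) s)"
      unfolding s_def
    proof (rule sum_indep_normal[OF finV Vne])
      show "indep_vars (\<lambda>p. borel) (\<lambda>p \<omega>. series_fun p (t q) * \<xi> p \<omega>) (V q)"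
        using indep_vars_subset[OF ind VI[OF qR]] by (rule indep_vars_compose2) simp
      show "0 < \<bar>series_fun p (t q)\<bar> * 1" if "p \<in> V q" for p using nz[OF that] by simp
      show "distributed M lborel (\<lambda>\<omega>. series_fun p (t q) * \<xi> p \<omega>)
          (normal_density 0 (\<bar>series_fun p (t q)\<bar> * 1))" if "p \<in> V q" for p
        using normal_density_affine[of "\<xi> p" 0 1 "series_fun p (t q)" 0] norm[of p] nz[OF that] VI[OF qR] that
        by auto
    qed
    then have D: "distributed M lborel (\<lambda>\<omega>. a q (\<lambda>i\<in>V q. \<xi> i \<omega>)) (normal_density 0 s)"
      by (simp add: a_restrict mult.commute)
    have y: "y \<ge> 0" by (simp add: y_def)
    have "\<theta> = c * sqrt (real j) / (4 * 2 ^ j) * y" by (simp add: \<theta>_def y_def)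
    also have "\<dots> \<le> s * y" using s y by (rule mult_right_mono)
    finally have \<theta>: "\<theta> \<le> s * y" .
    have [measurable]: "random_variable borel (\<lambda>\<omega>. a q (\<lambda>i\<in>V q. \<xi> i \<omega>))"
      using distributed_measurable[OF D] by simp
    show "\<rho> \<le> prob {\<omega> \<in> space M. a q (\<lambda>i\<in>V q. \<xi> i \<omega>) \<ge> \<theta>}"
      unfolding \<rho>_def using \<theta>
      by (intro order_trans[OF normal_upper_tail_ge[OF D s_pos y]] finite_measure_mono) auto
    show "\<rho> \<le> prob {\<omega> \<in> space M. a q (\<lambda>i\<in>V q. \<xi> i \<omega>) \<le> - \<theta>}"
      unfolding \<rho>_def using \<theta>
      by (intro order_trans[OF normal_lower_tail_ge[OF D s_pos y]] finite_measure_mono) auto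
  qed
  define E where "E = {\<omega> \<in> space M. \<forall>q<R. q \<in> Q \<longrightarrow>
      \<bar>a q (\<lambda>i\<in>V q. \<xi> i \<omega>) + b q (\<lambda>i\<in>G q. \<xi> i \<omega>)\<bar> < \<theta>}"
  have "prob E \<le> (1 - \<rho>) ^ card (Q \<inter> {..<R})"
    unfolding E_def
    by (rule prob_all_small_le[OF ind]) (rule G_step GV GI a_meas b_meas tails | assumption)+
  also have "Q \<inter> {..<R} = Q" by (auto simp: Q_def)
  also have "(1 - \<rho>) ^ card Q \<le> 1 / 2"
  proof -
    have "R > 0" by (simp add: R_def)
    then have Qne: "card Q > 0" using cardQ by linarith
    then obtain q where "q \<in> Q" by (metis card_gt_0_iff ex_in_conv)
    then have p1: "\<rho> \<le> 1" using tails(1)[of q] prob_le_1 order_trans by blast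
    \<comment> \<open>trades the shift by \<open>1\<close> for a factor \<open>2\<close>, which costs only a constant in the exponent\<close>
    have "(y + 1)\<^sup>2 / 2 \<le> real j / 4 + 1"
    proof -
      have "(y + 1)\<^sup>2 + (y - 1)\<^sup>2 = 2 * y\<^sup>2 + 2" by (simp add: power2_eq_square algebra_simps)
      moreover have "y\<^sup>2 = real j / 4" by (simp add: y_def power_divide)
      ultimately show ?thesis using zero_le_power2[of "y - 1"] by linarith
    qed
    then have p: "exp (- (real j / 4) - 1) / sqrt (2 * pi) \<le> \<rho>"
      unfolding \<rho>_def by (intro divide_right_mono) auto
    have "2 powr (real j / 2) / 4 \<le> real (card Q)"
    proof -
      have "2 powr (real j / 2) / 2 = 2 powr (real j / 2 - 1)" by (simp add: powr_diff)
      also have "\<dots> \<le> 2 powr real (j - j div 2 - 1)"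
        by (intro powr_mono) (use j in linarith)+
      also have "\<dots> = real R" by (simp add: R_def powr_realpow)
      finally show ?thesis using cardQ by linarith
    qed
    then have "2 powr (real j / 2) / 4 * (exp (- (real j / 4) - 1) / sqrt (2 * pi)) \<le> real (card Q) * \<rho>"
      using p by (intro mult_mono) auto
    moreover have "1 \<le> 2 powr (real j / 2) / 4 * (exp (- (real j / 4) - 1) / sqrt (2 * pi))"
    proof -
      have "4 * sqrt (2 * pi) \<le> real j / 12" using large by simp
      also have "\<dots> \<le> exp (real j / 12 - 1)" using exp_ge_add_one_self[of "real j / 12 - 1"] by simp
      also have "\<dots> = exp (real j / 3) * exp (- (real j / 4) - 1)" by (simp add: exp_add[symmetric])
      also have "\<dots> \<le> 2 powr (real j / 2) * exp (- (real j / 4) - 1)"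
      proof (intro mult_right_mono)
        \<comment> \<open>\<open>ln 2 \<ge> 2 / 3\<close> makes the growth rate \<open>1 / 3\<close> exceed the loss \<open>1 / 4\<close>\<close>
        have "real j / 2 * (2 / 3) \<le> real j / 2 * ln 2"
          by (intro mult_left_mono ln2_ge_two_thirds) simp
        then show "exp (real j / 3) \<le> 2 powr (real j / 2)" by (simp add: powr_def)
      qed simp
      finally show ?thesis by (simp add: field_simps)
    qed
    ultimately have pQ: "1 \<le> real (card Q) * \<rho>" by linarith
    have "(1 - \<rho>) ^ card Q \<le> exp (- \<rho>) ^ card Q"
      using p1 exp_ge_add_one_self[of "- \<rho>"] by (intro power_mono) auto
    also have "\<dots> = exp (- (real (card Q) * \<rho>))" by (simp add: exp_of_nat_mult[symmetric])
    also have "\<dots> \<le> exp (- 1)" using pQ by simp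
    also have "\<dots> \<le> 1 / 2" using exp_ge_add_one_self[of 1] by (simp add: exp_minus field_simps)
    finally show ?thesis .
  qed
  finally have E_half: "prob E \<le> 1 / 2" .
  have E_meas[measurable]: "E \<in> sets M"
  proof -
    have "(\<lambda>\<omega>. a q (\<lambda>i\<in>V q. \<xi> i \<omega>) + b q (\<lambda>i\<in>G q. \<xi> i \<omega>)) \<in> borel_measurable M" if "q < R" for q
    proof -
      have "(\<lambda>\<omega>. \<lambda>i\<in>V q. \<xi> i \<omega>) \<in> measurable M (PiM (V q) (\<lambda>_. borel))"
        "(\<lambda>\<omega>. \<lambda>i\<in>G q. \<xi> i \<omega>) \<in> measurable M (PiM (G q) (\<lambda>_. borel))"
        using VI[OF that] by (auto intro!: measurable_restrict \<xi> simp: G_def)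
      from measurable_compose[OF this(1) a_meas] measurable_compose[OF this(2) b_meas]
      show ?thesis by (rule borel_measurable_add)
    qed
    then have "{\<omega> \<in> space M. q \<in> Q \<longrightarrow> \<bar>a q (\<lambda>i\<in>V q. \<xi> i \<omega>) + b q (\<lambda>i\<in>G q. \<xi> i \<omega>)\<bar> < \<theta>} \<in> sets M"
      if "q \<in> {..<R}" for q
      using that by (cases "q \<in> Q") auto
    then have "{\<omega> \<in> space M. \<forall>q\<in>{..<R}. q \<in> Q \<longrightarrow> \<bar>a q (\<lambda>i\<in>V q. \<xi> i \<omega>) + b q (\<lambda>i\<in>G q. \<xi> i \<omega>)\<bar> < \<theta>} \<in> sets M"
      by (intro sets.sets_Collect_finite_All) auto
    then show ?thesis unfolding E_def Ball_def lessThan_iff .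
  qed
  have range_\<sigma>: "\<sigma> (n + i) \<in> haar_indices" for i using bij n by (auto simp: bij_betw_def)
  have "AE \<omega> in M. \<forall>q\<in>{..<R}. summable (\<lambda>i. \<xi> (\<sigma> (n + i)) \<omega> * series_fun (\<sigma> (n + i)) (t q))"
    by (intro AE_finite_allI AE_summable_random_series norm range_\<sigma> summable_abs_series_fun[OF bij n(1)])
       (use t in auto)
  then have ae: "AE \<omega> in M. ennreal \<theta> * indicator (space M - E) \<omega> \<le> unif_norm (series_tail (\<lambda>p. \<xi> p \<omega>) \<sigma> n)"
  proof (rule AE_mp, intro AE_I2 impI)
    fix \<omega> assume \<omega>: "\<omega> \<in> space M"
      and sm: "\<forall>q\<in>{..<R}. summable (\<lambda>i. \<xi> (\<sigma> (n + i)) \<omega> * series_fun (\<sigma> (n + i)) (t q))"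
    show "ennreal \<theta> * indicator (space M - E) \<omega> \<le> unif_norm (series_tail (\<lambda>p. \<xi> p \<omega>) \<sigma> n)"
    proof (cases "\<omega> \<in> E")
      case False
      then obtain q where q: "q < R" and
        big: "\<theta> \<le> \<bar>a q (\<lambda>i\<in>V q. \<xi> i \<omega>) + b q (\<lambda>i\<in>G q. \<xi> i \<omega>)\<bar>"
        using \<omega> by (auto simp: E_def not_less)
      have inj: "inj_on \<sigma> {n..}" using bij n by (auto simp: bij_betw_def intro: inj_on_subset)
      have "\<sigma> ` {1..<n} \<inter> \<sigma> ` {n..} = \<sigma> ` ({1..<n} \<inter> {n..})"
        by (rule inj_on_image_Int[OF bij_betw_imp_inj_on[OF bij], symmetric]) (use n in auto)
      also have "\<dots> = {}" by auto
      finally have "\<sigma> ` {1..<n} \<inter> \<sigma> ` {n..} = {}" .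
      moreover have split: "haar_indices = \<sigma> ` {1..<n} \<union> \<sigma> ` {n..}"
      proof -
        have "{1..} = {1..<n} \<union> {n..}" using n by auto
        then show ?thesis using bij by (metis bij_betw_def image_Un)
      qed
      ultimately have Zn: "p \<in> \<sigma> ` {n..} \<longleftrightarrow> p \<notin> \<sigma> ` {1..<n}" if "p \<in> haar_indices" for p
        using that by blast
      have Vn: "V q \<subseteq> \<sigma> ` {n..}" using VI[OF q] Zn by (auto simp: V_def Z_def)
      have "series_tail (\<lambda>p. \<xi> p \<omega>) \<sigma> n (t q) = (\<Sum>p\<in>V q. \<xi> p \<omega> * series_fun p (t q)) + b q (\<lambda>p. \<xi> p \<omega>)"
        unfolding b_def
      proof (rule series_tail_split[OF _ inj finV Vn])
        show "summable (\<lambda>i. \<xi> (\<sigma> (n + i)) \<omega> * series_fun (\<sigma> (n + i)) (t q))" using sm q by simp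
        show "V q \<inter> G q = {}" using GV by blast
        fix p assume p: "p \<in> \<sigma> ` {n..}" "p \<notin> V q" "p \<notin> G q"
        then have pI: "p \<in> haar_indices" using split by blast
        then obtain k where k: "p = Haar j k" "k \<ge> 2 * q * L" using p(3) by (auto simp: G_def)
        have "k \<notin> Z" using Zn[OF pI] p(1) k by (simp add: Z_def)
        then have "m q \<le> k" using p(2) k by (auto simp: V_def)
        then show "series_fun p (t q) = 0"
          unfolding k t_def by (intro series_fun_Haar_eq_0 divide_right_mono) auto
      qed
      then have "\<theta> \<le> \<bar>series_tail (\<lambda>p. \<xi> p \<omega>) \<sigma> n (t q)\<bar>"
        using big by (simp add: a_restrict b_restrict)
      then have "ennreal \<theta> \<le> ennreal \<bar>series_tail (\<lambda>p. \<xi> p \<omega>) \<sigma> n (t q)\<bar>" by (rule ennreal_leI)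
      also have "\<dots> \<le> unif_norm (series_tail (\<lambda>p. \<xi> p \<omega>) \<sigma> n)"
        unfolding unif_norm_def by (rule SUP_upper) (rule t[OF q])
      finally show ?thesis using \<omega> False by simp
    qed simp
  qed
  have "\<theta> \<ge> 0" using c by (simp add: \<theta>_def)
  then have "\<theta> * (1 / 2) \<le> \<theta> * prob (space M - E)"
    using E_half by (intro mult_left_mono) (auto simp: prob_compl)
  then have "ennreal (\<theta> / 2) \<le> ennreal \<theta> * emeasure M (space M - E)"
    using \<open>\<theta> \<ge> 0\<close> by (simp add: emeasure_eq_measure ennreal_mult[symmetric] ennreal_leI)
  also have "\<dots> = (\<integral>\<^sup>+\<omega>. ennreal \<theta> * indicator (space M - E) \<omega> \<partial>M)"
    by (rule nn_integral_cmult_indicator[symmetric]) simp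
  also have "\<dots> \<le> (\<integral>\<^sup>+\<omega>. unif_norm (series_tail (\<lambda>p. \<xi> p \<omega>) \<sigma> n) \<partial>M)"
    by (rule nn_integral_mono_AE[OF ae])
  also have "\<theta> / 2 = 3 / (16 * Gamma (5 / 2)) / 16 * real j / 2 ^ j"
    unfolding \<theta>_def c_def by simp
  finally show ?thesis .
qed

theorem theorem1:
  fixes M :: "'a measure"
    and \<xi> :: "haar_index \<Rightarrow> 'a \<Rightarrow> real"
    and \<sigma> :: "nat \<Rightarrow> haar_index"
  assumes "prob_space M"
    and "prob_space.indep_vars M (\<lambda>_. borel) \<xi> haar_indices"
    and "\<And>p. p \<in> haar_indices \<Longrightarrow> distributed M lborel (\<xi> p) std_normal_density"
    and "bij_betw \<sigma> {1..} haar_indices"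
  shows "liminf (\<lambda>n. (\<integral>\<^sup>+\<omega>. unif_norm (series_tail (\<lambda>p. \<xi> p \<omega>) \<sigma> n) \<partial>M)
                      / ennreal (ln (real n) / real n)) > 0"
proof -
  interpret prob_space M by fact
  define C :: real where "C = 3 / (16 * Gamma (5 / 2)) / 256"
  have C: "C > 0" using Gamma_five_half_pos by (simp add: C_def)
  obtain J :: nat where J: "48 * sqrt (2 * pi) \<le> real J" using real_arch_simple by blast
  have "ennreal C \<le> (\<integral>\<^sup>+\<omega>. unif_norm (series_tail (\<lambda>p. \<xi> p \<omega>) \<sigma> n) \<partial>M) / ennreal (ln (real n) / real n)"
    if n: "n \<ge> 2 ^ J + 2" for n
  proof -
    obtain i where i: "2 ^ i \<le> n" "n < 2 ^ (i + 1)" using ex_power_ivl1[of 2 n] n by auto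
    \<comment> \<open>the least shift for which \<open>n < 2 ^ (i + 1)\<close> gives \<open>8 * n \<le> 2 ^ j\<close>\<close>
    define j where "j = i + 4"
    have jn: "8 * n \<le> 2 ^ j" "2 ^ j \<le> 16 * n" using i by (auto simp: j_def power_add)
    have "2 ^ J < (2 :: nat) ^ j" using n jn by linarith
    then have "J \<le> j" by simp
    have "real n \<le> 2 ^ j" using of_nat_mono[of n "2 ^ j", where 'a = real] jn by simp
    then have "ln (real n) \<le> ln (2 ^ j)" using n by (subst ln_le_cancel_iff) auto
    also have "\<dots> \<le> real j" using ln_le_minus_one[of "2 :: real"] by (simp add: ln_realpow mult_left_le)
    finally have ln_j: "ln (real n) \<le> real j" .
    have "(2 :: real) ^ j \<le> 16 * real n" using of_nat_mono[OF jn(2), where 'a = real] by simp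
    then have "C * (ln (real n) / real n) \<le> 16 * C * real j / 2 ^ j"
    proof -
      have "C * (ln (real n) / real n) = 16 * C * ln (real n) / (16 * real n)" by simp
      also have "\<dots> \<le> 16 * C * real j / 2 ^ j"
        using ln_j C \<open>2 ^ j \<le> 16 * real n\<close> by (intro frac_le mult_left_mono) auto
      finally show ?thesis .
    qed
    then have "ennreal (C * (ln (real n) / real n)) \<le> ennreal (3 / (16 * Gamma (5 / 2)) / 16 * real j / 2 ^ j)"
      by (intro ennreal_leI) (simp add: C_def)
    also have "\<dots> \<le> (\<integral>\<^sup>+\<omega>. unif_norm (series_tail (\<lambda>p. \<xi> p \<omega>) \<sigma> n) \<partial>M)"
      using n jn J \<open>J \<le> j\<close>
      by (intro expected_norm_series_tail_ge assms) auto
    finally have "ennreal C * ennreal (ln (real n) / real n) \<le> (\<integral>\<^sup>+\<omega>. unif_norm (series_tail (\<lambda>p. \<xi> p \<omega>) \<sigma> n) \<partial>M)"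
      using C n by (subst ennreal_mult[symmetric]) auto
    from divide_right_mono_ennreal[OF this, of "ennreal (ln (real n) / real n)"]
    show ?thesis using n by (simp add: ennreal_mult_divide_eq)
  qed
  then have "ennreal C \<le> liminf (\<lambda>n. (\<integral>\<^sup>+\<omega>. unif_norm (series_tail (\<lambda>p. \<xi> p \<omega>) \<sigma> n) \<partial>M)
                      / ennreal (ln (real n) / real n))"
    by (intro Liminf_bounded) (auto simp: eventually_sequentially)
  moreover have "0 < ennreal C" using C by simp
  ultimately show ?thesis by (rule less_le_trans[rotated])
qed

end
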